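(* If $X$ is a topological space and $Y$ is a disconnected metrizable separable space, then the following conditions are equivalent: (1) $X$ is almost strongly zero-dimensional; (2) $\mathrm{K}_1(X,Y)=\mathrm{B}_1(X,Y)$.
   Context: Zero sets of a topological space $X$ are sets of the form $g^{-1}(0)$ with $g:X\to[0,1]$ continuous. A subset of $X$ is functionally $F_\sigma$ if it is a union of a sequence of zero sets. $\mathrm{B}_1(X,Y)$ is the set of mappings $f:X\to Y$ that are pointwise limits of a sequence of continuous mappings $X\to Y$; $\mathrm{K}_1(X,Y)$ is the set of mappings $f:X\to Y$ such that $f^{-1}(V)$ is functionally $F_\sigma$ in $X$ for every open $V\subseteq Y$. A subset $F$ of $X$ is a $C$-set if there is a sequence $(U_n)_{n=1}^\infty$ of clopen sets in $X$ with $F=\bigcap_{n=1}^\infty U_n$. A set is a $C_\sigma$-set if it is a union of a sequence of $C$-sets. A topological space $X$ is almost strongly zero-dimensional if every zero subset of $X$ is a $C_\sigma$-set. *)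

theory Defs
  imports "HOL-Analysis.Analysis"
begin

definition zero_set_in :: "'a topology \<Rightarrow> 'a set \<Rightarrow> bool" where
  "zero_set_in X Z \<longleftrightarrow>
    (\<exists>g :: 'a \<Rightarrow> real. continuous_map X (top_of_set {0..1}) g \<and> Z = {x \<in> topspace X. g x = 0})"

definition functionally_F_sigma :: "'a topology \<Rightarrow> 'a set \<Rightarrow> bool" where
  "functionally_F_sigma X S \<longleftrightarrow>
    (\<exists>Z :: nat \<Rightarrow> 'a set. (\<forall>n. zero_set_in X (Z n)) \<and> S = (\<Union>n. Z n))"

(* Mappings between the spaces are represented by extensional functions on the carrier, so
   that equality of sets of mappings depends only on the values on topspace X. *)

definition B1 :: "'a topology \<Rightarrow> 'b topology \<Rightarrow> ('a \<Rightarrow> 'b) set" where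
  "B1 X Y = {f \<in> topspace X \<rightarrow>\<^sub>E topspace Y.
    \<exists>g :: nat \<Rightarrow> 'a \<Rightarrow> 'b. (\<forall>n. continuous_map X Y (g n)) \<and>
      (\<forall>x \<in> topspace X. limitin Y (\<lambda>n. g n x) (f x) sequentially)}"

definition K1 :: "'a topology \<Rightarrow> 'b topology \<Rightarrow> ('a \<Rightarrow> 'b) set" where
  "K1 X Y = {f \<in> topspace X \<rightarrow>\<^sub>E topspace Y.
    \<forall>V. openin Y V \<longrightarrow> functionally_F_sigma X {x \<in> topspace X. f x \<in> V}}"

definition C_set :: "'a topology \<Rightarrow> 'a set \<Rightarrow> bool" where
  "C_set X F \<longleftrightarrow>
    (\<exists>U :: nat \<Rightarrow> 'a set. (\<forall>n. openin X (U n) \<and> closedin X (U n)) \<and> F = (\<Inter>n. U n))"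

definition C_sigma_set :: "'a topology \<Rightarrow> 'a set \<Rightarrow> bool" where
  "C_sigma_set X S \<longleftrightarrow> (\<exists>F :: nat \<Rightarrow> 'a set. (\<forall>n. C_set X (F n)) \<and> S = (\<Union>n. F n))"

definition almost_strongly_zero_dimensional :: "'a topology \<Rightarrow> bool" where
  "almost_strongly_zero_dimensional X \<longleftrightarrow> (\<forall>Z. zero_set_in X Z \<longrightarrow> C_sigma_set X Z)"

end

theory Submission
  imports Defs
begin

text \<open>
  A limit of continuous maps into a metrizable space is always in K1. An open set \<open>V\<close> of
  \<open>Y\<close> is the positivity set of a continuous real function \<open>\<phi>\<close>, namely the
  distance to the complement, so everything reduces to real limits: a limit is positive exactly when
  some \<open>1/(k+1)\<close> bounds the sequence from below from some index on. This is a countable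
  union of countable intersections of zero sets, and zero sets are closed under countable
  intersections (\<open>B1_subset_K1\<close>). The content of the theorem is thus the comparison of the
  zero-dimensionality condition with the inclusion of K1 in B1.

  If \<open>X\<close> is almost strongly zero-dimensional and \<open>f\<close> is in K1, then preimages
  of open sets are countable unions of C-sets. Using a countable dense subset of \<open>Y\<close>, for
  each \<open>n\<close> one covers \<open>X\<close> by C-sets \<open>E n i\<close>, each mapped by \<open>f\<close>
  into one ball of radius \<open>2^-n\<close>. Replacing each \<open>E n i\<close> by the \<open>m\<close>-th of a
  decreasing sequence of clopen sets that shrinks to it, one guesses at stage \<open>m\<close> which ball of
  each radius contains \<open>f x\<close>. The guesses are locally constant in \<open>x\<close>, and for fixed
  \<open>n\<close> and \<open>x\<close> they are eventually correct. The \<open>m\<close>-th approximation picks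
  a point common to the guessed balls of as many initial radii as possible. Once the first
  \<open>N+1\<close> guesses are correct, their balls do meet, since \<open>f x\<close> lies in all of them; so
  the chosen point lies in the same ball of radius \<open>2^-N\<close> as \<open>f x\<close>. Only
  finite intersections of balls occur, so no completeness of the metric enters (\<open>limit_of_C_set_approximations\<close>, \<open>K1_subset_B1\<close>).

  Conversely, let \<open>A\<close> be a nontrivial clopen subset of \<open>Y\<close> and \<open>Z\<close> a zero
  set. The map with a value in \<open>A\<close> on \<open>Z\<close> and a value outside \<open>A\<close>
  elsewhere is in K1, hence also in B1 if the two sets agree. If it is the limit of continuous maps \<open>g m\<close>, then \<open>Z\<close> consists
  of the points with \<open>g m x\<close> in \<open>A\<close> for all large \<open>m\<close>, which exhibits it as a
  countable union of C-sets.
\<close>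

section \<open>Zero sets\<close>

lemma zero_set_in_real:
  assumes "continuous_map X euclideanreal h"
  shows "zero_set_in X {x \<in> topspace X. h x = 0}"
proof -
  let ?g = "\<lambda>x. min 1 \<bar>h x\<bar>"
  have "continuous_map X euclideanreal ?g"
    using assms by (intro continuous_intros) auto
  then have "continuous_map X (top_of_set {0..1}) ?g"
    by (simp add: continuous_map_in_subtopology image_subset_iff)
  moreover have "{x \<in> topspace X. h x = 0} = {x \<in> topspace X. ?g x = 0}"
    by (auto simp: min_def)
  ultimately show ?thesis
    unfolding zero_set_in_def by blast
qed

lemma zero_set_in_ge:
  assumes "continuous_map X euclideanreal h"
  shows "zero_set_in X {x \<in> topspace X. c \<le> h x}"
proof -
  have "zero_set_in X {x \<in> topspace X. max 0 (c - h x) = 0}"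
    using assms by (intro zero_set_in_real continuous_intros) auto
  moreover have "{x \<in> topspace X. c \<le> h x} = {x \<in> topspace X. max 0 (c - h x) = 0}"
    by (auto simp: max_def)
  ultimately show ?thesis
    by simp
qed

text \<open>
  The common zeros of the nonnegative functions \<open>g n\<close> are the zeros of the uniformly convergent
  series of the \<open>2^-n * g n\<close>.
\<close>
lemma zero_set_in_INT:
  assumes "\<And>n::nat. zero_set_in X (Z n)"
  shows "zero_set_in X (\<Inter>n. Z n)"
proof -
  have "\<forall>n. \<exists>g. continuous_map X (top_of_set {0..1::real}) g \<and> Z n = {x \<in> topspace X. g x = 0}"
    using assms unfolding zero_set_in_def by blast
  then obtain g where g: "\<And>n. continuous_map X (top_of_set {0..1::real}) (g n)"
    and Z: "\<And>n. Z n = {x \<in> topspace X. g n x = 0}"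
    by metis
  have cont: "continuous_map X euclideanreal (g n)" for n
    using g[of n] by (simp add: continuous_map_in_subtopology)
  have g01: "0 \<le> g n x" "g n x \<le> 1" if "x \<in> topspace X" for n x
    using g[of n] that by (auto simp: continuous_map_in_subtopology)
  define t where "t n x = (1/2)^n * g n x" for n x
  have t0: "0 \<le> t n x" if "x \<in> topspace X" for n x
    using g01[OF that] by (simp add: t_def)
  have bound: "norm (t n x) \<le> (1/2)^n" if "x \<in> topspace X" for n x
    using g01[OF that, of n] by (simp add: t_def)
  have summ: "summable (\<lambda>n. t n x)" if "x \<in> topspace X" for x
    by (rule summable_comparison_test'[where g="\<lambda>n. (1/2)^n" and N=0]) (use bound[OF that] in auto)
  have "uniform_limit (topspace X) (\<lambda>n x. \<Sum>i<n. t i x) (\<lambda>x. suminf (\<lambda>i. t i x)) sequentially"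
    by (rule Weierstrass_m_test[where M="\<lambda>n. (1/2)^n"]) (use bound in auto)
  moreover have "continuous_map X euclideanreal (\<lambda>x. \<Sum>i<n. t i x)" for n
    unfolding t_def by (intro continuous_intros cont) auto
  ultimately have "continuous_map X Met_TC.mtopology (\<lambda>x. suminf (\<lambda>i. t i x))"
    by (intro Met_TC.continuous_map_uniform_limit
          [where F=sequentially and f="\<lambda>n x. \<Sum>i<n. t i x"])
       (auto simp: uniform_limit_iff)
  then have "zero_set_in X {x \<in> topspace X. suminf (\<lambda>i. t i x) = 0}"
    by (intro zero_set_in_real) simp
  moreover have "(\<Inter>n. Z n) = {x \<in> topspace X. suminf (\<lambda>i. t i x) = 0}"
    using suminf_eq_zero_iff[OF summ t0] by (auto simp: Z t_def)
  ultimately show ?thesis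
    by simp
qed

section \<open>Unions of sequences\<close>

lemma UN_prod_decode:
  "(\<Union>j. A (fst (prod_decode j)) (snd (prod_decode j))) = (\<Union>k n. A k n)"
proof (intro equalityI subsetI)
  fix x assume "x \<in> (\<Union>k n. A k n)"
  then obtain k n where "x \<in> A k n"
    by blast
  then show "x \<in> (\<Union>j. A (fst (prod_decode j)) (snd (prod_decode j)))"
    by (intro UN_I[of "prod_encode (k, n)"]) auto
qed blast

lemma functionally_F_sigma_UN2:
  fixes Z :: "nat \<Rightarrow> nat \<Rightarrow> 'a set"
  assumes "\<And>k n. zero_set_in X (Z k n)"
  shows "functionally_F_sigma X (\<Union>k n. Z k n)"
  unfolding functionally_F_sigma_def
  using assms UN_prod_decode[of Z]
  by (intro exI[of _ "\<lambda>j. Z (fst (prod_decode j)) (snd (prod_decode j))"]) simp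

lemma C_sigma_set_UN:
  assumes "\<And>k::nat. C_sigma_set X (S k)"
  shows "C_sigma_set X (\<Union>k. S k)"
proof -
  have "\<forall>k. \<exists>F. (\<forall>n::nat. C_set X (F n)) \<and> S k = (\<Union>n. F n)"
    using assms unfolding C_sigma_set_def by blast
  then obtain F where F: "\<And>k n. C_set X (F k n)" and S: "\<And>k. S k = (\<Union>n::nat. F k n)"
    by metis
  show ?thesis
    unfolding C_sigma_set_def S
    using F UN_prod_decode[of F]
    by (intro exI[of _ "\<lambda>j. F (fst (prod_decode j)) (snd (prod_decode j))"]) simp
qed

section \<open>Pointwise limits of continuous maps\<close>

lemma functionally_F_sigma_limit_positive:
  fixes h :: "nat \<Rightarrow> 'a \<Rightarrow> real"
  assumes cont: "\<And>m. continuous_map X euclideanreal (h m)"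
    and lim: "\<And>x. x \<in> topspace X \<Longrightarrow> (\<lambda>m. h m x) \<longlonglongrightarrow> l x"
  shows "functionally_F_sigma X {x \<in> topspace X. 0 < l x}"
proof -
  define Z where "Z k n = (\<Inter>m. {x \<in> topspace X. inverse (Suc k) \<le> h (n + m) x})" for k n
  have "zero_set_in X (Z k n)" for k n
    unfolding Z_def by (intro zero_set_in_INT zero_set_in_ge cont)
  then have "functionally_F_sigma X (\<Union>k n. Z k n)"
    by (rule functionally_F_sigma_UN2)
  moreover have "(\<Union>k n. Z k n) = {x \<in> topspace X. 0 < l x}"
  proof (intro equalityI subsetI)
    fix x assume "x \<in> (\<Union>k n. Z k n)"
    then obtain k n where x: "x \<in> topspace X" and ge: "\<And>m. inverse (Suc k) \<le> h (n + m) x"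
      by (auto simp: Z_def)
    have "inverse (Suc k) \<le> l x"
      by (rule LIMSEQ_le_const[OF lim[OF x]]) (metis ge le_Suc_ex)
    moreover have "0 < inverse (real (Suc k))"
      by simp
    ultimately have "0 < l x"
      by (rule order.strict_trans2[rotated])
    with x show "x \<in> {x \<in> topspace X. 0 < l x}"
      by simp
  next
    fix x assume "x \<in> {x \<in> topspace X. 0 < l x}"
    then have x: "x \<in> topspace X" "0 < l x"
      by auto
    obtain k where k: "inverse (Suc k) < l x"
      using reals_Archimedean[OF x(2)] by auto
    have "\<forall>\<^sub>F m in sequentially. inverse (Suc k) < h m x"
      using order_tendstoD(1)[OF lim[OF x(1)] k] .
    then obtain n where "\<And>m. m \<ge> n \<Longrightarrow> inverse (Suc k) < h m x"
      by (auto simp: eventually_sequentially)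
    then have "x \<in> Z k n"
      using x by (auto simp: Z_def intro!: less_imp_le)
    then show "x \<in> (\<Union>k n. Z k n)"
      by blast
  qed
  ultimately show ?thesis
    by simp
qed

text \<open>
  The function is the distance to the complement of \<open>V\<close>; it is 1-Lipschitz. The infimum would
  be over the empty set for \<open>V = topspace Y\<close>, which is treated apart.
\<close>
lemma metrizable_open_eq_positive_set:
  assumes "metrizable_space Y" and V: "openin Y V"
  shows "\<exists>\<phi>. continuous_map Y euclideanreal \<phi> \<and> V = {y \<in> topspace Y. 0 < \<phi> y}"
proof (cases "V = topspace Y")
  case True
  then show ?thesis
    by (intro exI[of _ "\<lambda>_. 1"]) auto
next
  case False
  obtain M d where md: "Metric_space M d" and Y: "Y = Metric_space.mtopology M d"
    using assms unfolding metrizable_space_def by blast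
  interpret Metric_space M d by (rule md)
  have VM: "V \<subseteq> M" and ball: "\<And>y. y \<in> V \<Longrightarrow> \<exists>r>0. mball y r \<subseteq> V"
    using V by (auto simp: Y openin_mtopology)
  have ne: "M - V \<noteq> {}"
    using False VM by (auto simp: Y)
  define \<phi> where "\<phi> y = (INF z\<in>M - V. d y z)" for y
  have bdd: "bdd_below (d y ` (M - V))" for y
    by (rule bdd_belowI[of _ 0]) auto
  have lip: "\<phi> y \<le> d y y' + \<phi> y'" if "y \<in> M" "y' \<in> M" for y y'
  proof -
    have "\<phi> y - d y y' \<le> \<phi> y'"
      unfolding \<phi>_def[of y']
    proof (rule cINF_greatest[OF ne])
      fix z assume z: "z \<in> M - V"
      have "\<phi> y \<le> d y z"
        unfolding \<phi>_def by (rule cINF_lower[OF bdd z])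
      also have "\<dots> \<le> d y y' + d y' z"
        using z that by (intro triangle) auto
      finally show "\<phi> y - d y y' \<le> d y' z"
        by simp
    qed
    then show ?thesis
      by simp
  qed
  have "continuous_map mtopology Met_TC.mtopology \<phi>"
    unfolding metric_continuous_map[OF Met_TC.Metric_space_axioms]
  proof (intro conjI ballI allI impI)
    fix y \<epsilon> assume y: "y \<in> M" and "(0::real) < \<epsilon>"
    moreover have "dist (\<phi> y) (\<phi> y') < \<epsilon>" if "y' \<in> M" "d y y' < \<epsilon>" for y'
      using lip[OF y that(1)] lip[OF that(1) y] that(2) commute[of y y']
      by (auto simp: dist_real_def)
    ultimately show "\<exists>\<delta>>0. \<forall>y'. y' \<in> M \<and> d y y' < \<delta> \<longrightarrow> dist (\<phi> y) (\<phi> y') < \<epsilon>"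
      by blast
  qed auto
  moreover have "0 < \<phi> y \<longleftrightarrow> y \<in> V" if y: "y \<in> M" for y
  proof
    assume "0 < \<phi> y"
    show "y \<in> V"
    proof (rule ccontr)
      assume "y \<notin> V"
      then have "\<phi> y \<le> d y y"
        unfolding \<phi>_def using y by (intro cINF_lower[OF bdd]) auto
      with \<open>0 < \<phi> y\<close> y show False
        by simp
    qed
  next
    assume "y \<in> V"
    then obtain r where r: "r > 0" "mball y r \<subseteq> V"
      using ball by blast
    have "r \<le> \<phi> y"
      unfolding \<phi>_def
    proof (rule cINF_greatest[OF ne])
      fix z assume "z \<in> M - V"
      then show "r \<le> d y z"
        using r y by (force simp: in_mball)
    qed
    with r show "0 < \<phi> y"
      by simp
  qed
  ultimately show ?thesis
    using VM by (intro exI[of _ \<phi>]) (auto simp: Y)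
qed

lemma B1_subset_K1:
  assumes "metrizable_space Y"
  shows "B1 X Y \<subseteq> K1 X Y"
proof
  fix f assume f: "f \<in> B1 X Y"
  then obtain g where fE: "f \<in> topspace X \<rightarrow>\<^sub>E topspace Y"
    and g: "\<And>n::nat. continuous_map X Y (g n)"
    and lim: "\<And>x. x \<in> topspace X \<Longrightarrow> limitin Y (\<lambda>n. g n x) (f x) sequentially"
    unfolding B1_def by blast
  have "functionally_F_sigma X {x \<in> topspace X. f x \<in> V}" if V: "openin Y V" for V
  proof -
    obtain \<phi> where \<phi>: "continuous_map Y euclideanreal \<phi>" and Veq: "V = {y \<in> topspace Y. 0 < \<phi> y}"
      using metrizable_open_eq_positive_set[OF assms V] by blast
    have "functionally_F_sigma X {x \<in> topspace X. 0 < \<phi> (f x)}"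
    proof (rule functionally_F_sigma_limit_positive)
      show "continuous_map X euclideanreal (\<phi> \<circ> g m)" for m
        using continuous_map_compose[OF g \<phi>] .
      show "(\<lambda>m. (\<phi> \<circ> g m) x) \<longlonglongrightarrow> \<phi> (f x)" if "x \<in> topspace X" for x
        using continuous_map_limit[OF \<phi> lim[OF that]] by (simp add: o_def)
    qed
    moreover have "{x \<in> topspace X. f x \<in> V} = {x \<in> topspace X. 0 < \<phi> (f x)}"
      using fE by (auto simp: Veq)
    ultimately show ?thesis
      by simp
  qed
  with fE show "f \<in> K1 X Y"
    by (auto simp: K1_def)
qed

section \<open>Approximation by locally constant maps\<close>

text \<open>
  A map that depends only on membership of its argument in finitely many clopen sets is constant on
  the atoms of the Boolean algebra that they generate, and these atoms are open.
\<close>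
lemma continuous_map_finite_clopen:
  assumes "finite \<U>" and "\<And>U. U \<in> \<U> \<Longrightarrow> openin X U \<and> closedin X U"
    and fY: "\<And>x. x \<in> topspace X \<Longrightarrow> f x \<in> topspace Y"
    and det: "\<And>x x'. \<lbrakk>x \<in> topspace X; x' \<in> topspace X; \<And>U. U \<in> \<U> \<Longrightarrow> x \<in> U \<longleftrightarrow> x' \<in> U\<rbrakk> \<Longrightarrow> f x = f x'"
  shows "continuous_map X Y f"
proof -
  have "openin X {x \<in> topspace X. f x \<in> W}" for W
  proof (subst openin_subopen, intro ballI)
    fix x assume x: "x \<in> {x \<in> topspace X. f x \<in> W}"
    define N where "N = topspace X \<inter> (\<Inter>U\<in>\<U>. if x \<in> U then U else topspace X - U)"
    have "openin X (if x \<in> U then U else topspace X - U)" if "U \<in> \<U>" for U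
      using assms(2)[OF that] by auto
    then have "openin X N"
      unfolding N_def Int_commute[of "topspace X"] using \<open>finite \<U>\<close> by (intro openin_INT)
    moreover have "x \<in> N"
      using x by (auto simp: N_def)
    moreover have "N \<subseteq> {x \<in> topspace X. f x \<in> W}"
    proof
      fix x' assume x': "x' \<in> N"
      then have "x' \<in> topspace X"
        by (simp add: N_def)
      moreover have "x \<in> U \<longleftrightarrow> x' \<in> U" if "U \<in> \<U>" for U
        using x' that by (auto simp: N_def split: if_splits)
      ultimately show "x' \<in> {x \<in> topspace X. f x \<in> W}"
        using det[of x x'] x by auto
    qed
    ultimately show "\<exists>T. openin X T \<and> x \<in> T \<and> T \<subseteq> {x \<in> topspace X. f x \<in> W}"
      by blast
  qed
  with fY show ?thesis
    by (auto simp: continuous_map_def)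
qed

text \<open>
  The heart of the passage from K1 to B1: countable covers by C-sets on which \<open>f\<close> varies little
  are turned into a sequence of locally constant maps converging to \<open>f\<close>.
\<close>
lemma limit_of_C_set_approximations:
  fixes X :: "'a topology" and M :: "'b set"
  assumes md: "Metric_space M d"
    and f: "\<And>x. x \<in> topspace X \<Longrightarrow> f x \<in> M"
    and C: "\<And>n i::nat. C_set X (E n i)"
    and cover: "\<And>n x. x \<in> topspace X \<Longrightarrow> \<exists>i. x \<in> E n i"
    and near: "\<And>n i x. \<lbrakk>x \<in> topspace X; x \<in> E n i\<rbrakk> \<Longrightarrow> f x \<in> Metric_space.mball M d (y n i) ((1/2)^n)"
  shows "\<exists>g::nat \<Rightarrow> 'a \<Rightarrow> 'b. (\<forall>m. continuous_map X (Metric_space.mtopology M d) (g m)) \<and>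
      (\<forall>x \<in> topspace X. limitin (Metric_space.mtopology M d) (\<lambda>m. g m x) (f x) sequentially)"
proof -
  interpret Metric_space M d by (rule md)
  have "\<forall>n i. \<exists>U. (\<forall>m::nat. openin X (U m) \<and> closedin X (U m)) \<and> E n i = (\<Inter>m. U m)"
    using C unfolding C_set_def by blast
  then obtain U where U: "\<And>n i m::nat. openin X (U n i m) \<and> closedin X (U n i m)"
    and E: "\<And>n i. E n i = (\<Inter>m. U n i m)"
    by metis
  \<comment> \<open>The guess at stage \<open>m\<close> for the first cover element of level \<open>n\<close> that contains
     \<open>x\<close>. The alternative \<open>m \<le> i\<close> makes a guess exist always and confines the search to the
     finitely many clopen sets with indices up to \<open>m\<close>.\<close>
  define cell where "cell m x n = (LEAST i. m \<le> i \<or> (\<forall>k\<le>m. x \<in> U n i k))" for m x n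
  define meet where "meet c p = {z \<in> M. \<forall>n<p. z \<in> mball (y n (c n)) ((1/2)^n)}" for c :: "nat \<Rightarrow> nat" and p :: nat
  \<comment> \<open>Wrong guesses may give disjoint balls, hence the truncation. Indices range over \<open>n < p\<close>
     in \<open>meet\<close> so that depth 0 is always possible.\<close>
  define depth where "depth m c = (GREATEST p. p \<le> m \<and> meet c p \<noteq> {})" for m :: nat and c
  define g where "g m x = (SOME z. z \<in> meet (cell m x) (depth m (cell m x)))" for m x

  have depth: "depth m c \<le> m \<and> meet c (depth m c) \<noteq> {}" if "x \<in> topspace X" for m c x
    unfolding depth_def
  proof (rule GreatestI_nat[where P="\<lambda>p. p \<le> m \<and> meet c p \<noteq> {}" and k=0 and b=m])
    show "0 \<le> m \<and> meet c 0 \<noteq> {}"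
      using f[OF that] by (auto simp: meet_def)
  qed auto
  have depth_ge: "p \<le> depth m c" if "p \<le> m" "meet c p \<noteq> {}" for p m c
    unfolding depth_def
    by (rule Greatest_le_nat[where P="\<lambda>p. p \<le> m \<and> meet c p \<noteq> {}" and b=m]) (use that in auto)
  have g_meet: "g m x \<in> meet (cell m x) (depth m (cell m x))" if "x \<in> topspace X" for m x
    unfolding g_def by (rule someI_ex) (use depth[OF that] in blast)

  have cont: "continuous_map X mtopology (g m)" for m
  proof (rule continuous_map_finite_clopen)
    let ?\<U> = "(\<lambda>(n, i, k). U n i k) ` ({..m} \<times> {..m} \<times> {..m})"
    show "finite ?\<U>"
      by simp
    show "openin X W \<and> closedin X W" if "W \<in> ?\<U>" for W
      using that U by auto
    show "g m x \<in> topspace mtopology" if "x \<in> topspace X" for x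
      using g_meet[OF that, of m] by (simp add: meet_def)
    fix x x' assume x: "x \<in> topspace X" "x' \<in> topspace X" and eq: "\<And>W. W \<in> ?\<U> \<Longrightarrow> x \<in> W \<longleftrightarrow> x' \<in> W"
    have "x \<in> U n i k \<longleftrightarrow> x' \<in> U n i k" if "n \<le> m" "i \<le> m" "k \<le> m" for n i k
      by (rule eq) (use that in force)
    then have "(m \<le> i \<or> (\<forall>k\<le>m. x \<in> U n i k)) \<longleftrightarrow> (m \<le> i \<or> (\<forall>k\<le>m. x' \<in> U n i k))" if "n \<le> m" for n i
      using that by (meson nat_le_linear)
    then have cell: "cell m x n = cell m x' n" if "n \<le> m" for n
      using that by (simp add: cell_def)
    have meet: "meet (cell m x) p = meet (cell m x') p" if "p \<le> m" for p
      using that cell by (simp add: meet_def)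
    then have "depth m (cell m x) = depth m (cell m x')"
      unfolding depth_def by (metis (no_types, lifting))
    then show "g m x = g m x'"
      using meet depth[OF x(1)] by (simp add: g_def)
  qed

  have lim: "limitin mtopology (\<lambda>m. g m x) (f x) sequentially" if x: "x \<in> topspace X" for x
  proof -
    define c where "c n = (LEAST i. x \<in> E n i)" for n
    have cE: "x \<in> E n (c n)" for n
      unfolding c_def using cover[OF x] by (rule LeastI_ex)
    \<comment> \<open>The guess is correct once the finitely many earlier cover elements, none of which contains
       \<open>x\<close>, have been excluded.\<close>
    have cell_ev: "\<forall>\<^sub>F m in sequentially. cell m x n = c n" for n
    proof -
      have "\<forall>\<^sub>F m in sequentially. \<not> (\<forall>k\<le>m. x \<in> U n i k)" if "i < c n" for i
      proof -
        have "x \<notin> E n i"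
          using not_less_Least that unfolding c_def by blast
        then obtain k where "x \<notin> U n i k"
          by (auto simp: E)
        then show ?thesis
          by (auto simp: eventually_sequentially)
      qed
      then have "\<forall>\<^sub>F m in sequentially. \<forall>i\<in>{..<c n}. \<not> (\<forall>k\<le>m. x \<in> U n i k)"
        by (intro eventually_ball_finite) auto
      moreover have "\<forall>\<^sub>F m in sequentially. c n < m"
        by (rule eventually_gt_at_top)
      ultimately show ?thesis
      proof eventually_elim
        case (elim m)
        then show ?case
          unfolding cell_def
        proof (intro Least_equality)
          show "m \<le> c n \<or> (\<forall>k\<le>m. x \<in> U n (c n) k)"
            using cE[of n] by (auto simp: E)
          show "c n \<le> i" if "m \<le> i \<or> (\<forall>k\<le>m. x \<in> U n i k)" for i
            using that elim by (meson lessThan_iff less_imp_le not_le order_trans)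
        qed
      qed
    qed
    have close: "\<forall>\<^sub>F m in sequentially. d (g m x) (f x) < 2 * (1/2)^N" for N
    proof -
      have "\<forall>\<^sub>F m in sequentially. \<forall>n\<in>{..N}. cell m x n = c n"
        using cell_ev by (intro eventually_ball_finite) auto
      moreover have "\<forall>\<^sub>F m in sequentially. N < m"
        by (rule eventually_gt_at_top)
      ultimately show ?thesis
      proof eventually_elim
        case (elim m)
        have "f x \<in> mball (y n (c n)) ((1/2)^n)" for n
          using near[OF x cE] .
        then have "f x \<in> meet (cell m x) (Suc N)"
          using elim f[OF x] by (auto simp: meet_def less_Suc_eq_le simp del: in_mball)
        then have "Suc N \<le> depth m (cell m x)"
          using elim by (intro depth_ge) auto
        then have "g m x \<in> mball (y N (c N)) ((1/2)^N)"
          using g_meet[OF x, of m] elim by (auto simp: meet_def Suc_le_eq simp del: in_mball)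
        moreover have "f x \<in> mball (y N (c N)) ((1/2)^N)"
          using near[OF x cE] .
        ultimately show ?case
          using triangle[of "g m x" "y N (c N)" "f x"] commute[of "g m x" "y N (c N)"] by auto
      qed
    qed
    have "\<forall>\<^sub>F m in sequentially. g m x \<in> M \<and> d (g m x) (f x) < \<epsilon>" if "\<epsilon> > 0" for \<epsilon>
    proof -
      obtain N where N: "(1/2)^N < \<epsilon> / 2"
        using real_arch_pow_inv[of "\<epsilon>/2" "1/2"] \<open>\<epsilon> > 0\<close> by auto
      show ?thesis
        using close[of N]
      proof eventually_elim
        case (elim m)
        then show ?case
          using N g_meet[OF x, of m] by (auto simp: meet_def)
      qed
    qed
    then show ?thesis
      using f[OF x] by (simp add: limitin_metric)
  qed
  from cont lim show ?thesis
    by blast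
qed

lemma K1_subset_B1:
  fixes X :: "'a topology" and Y :: "'b topology"
  assumes "metrizable_space Y" and "separable_space Y" and asz: "almost_strongly_zero_dimensional X"
  shows "K1 X Y \<subseteq> B1 X Y"
proof
  fix f assume f: "f \<in> K1 X Y"
  then have fE: "f \<in> topspace X \<rightarrow>\<^sub>E topspace Y"
    by (simp add: K1_def)
  have Cs: "C_sigma_set X {x \<in> topspace X. f x \<in> V}" if V: "openin Y V" for V
  proof -
    obtain Z where "\<And>n::nat. zero_set_in X (Z n)" "{x \<in> topspace X. f x \<in> V} = (\<Union>n. Z n)"
      using f V unfolding K1_def functionally_F_sigma_def by blast
    then show ?thesis
      using asz C_sigma_set_UN[of X Z] by (simp add: almost_strongly_zero_dimensional_def)
  qed
  obtain M d where md: "Metric_space M d" and Y: "Y = Metric_space.mtopology M d"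
    using assms(1) unfolding metrizable_space_def by blast
  interpret Metric_space M d by (rule md)
  obtain D where D: "countable D" "D \<subseteq> M" "mtopology closure_of D = M"
    using assms(2) by (auto simp: separable_space_def Y)
  \<comment> \<open>If \<open>D\<close> is empty, then \<open>e\<close> enumerates no point of \<open>Y\<close>; but then \<open>X\<close> is
     empty and the covering condition below is vacuous.\<close>
  define e where "e = from_nat_into D"
  have "\<forall>n k. \<exists>F. (\<forall>j::nat. C_set X (F j)) \<and> {x \<in> topspace X. f x \<in> mball (e k) ((1/2)^n)} = (\<Union>j. F j)"
    using Cs[unfolded Y C_sigma_set_def] by (meson openin_mball)
  then obtain F where F: "\<And>n k j. C_set X (F n k j)"
    and Feq: "\<And>n k. {x \<in> topspace X. f x \<in> mball (e k) ((1/2)^n)} = (\<Union>j::nat. F n k j)"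
    by metis
  define E where "E n i = F n (fst (prod_decode i)) (snd (prod_decode i))" for n i
  have "\<exists>g::nat \<Rightarrow> 'a \<Rightarrow> 'b. (\<forall>m. continuous_map X mtopology (g m)) \<and>
      (\<forall>x \<in> topspace X. limitin mtopology (\<lambda>m. g m x) (f x) sequentially)"
  proof (rule limit_of_C_set_approximations[where E=E and y="\<lambda>n i. e (fst (prod_decode i))", OF md])
    show fM: "f x \<in> M" if "x \<in> topspace X" for x
      using fE that by (auto simp: Y)
    show "C_set X (E n i)" for n i
      using F by (simp add: E_def)
    show "\<exists>i. x \<in> E n i" if x: "x \<in> topspace X" for n x
    proof -
      have "f x \<in> {u \<in> M. \<forall>r>0. \<exists>z\<in>D. z \<in> mball u r}"
        using fM[OF x] D(3) unfolding metric_closure_of by argo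
      moreover have "(0::real) < (1/2)^n"
        by simp
      ultimately obtain z where z: "z \<in> D" "z \<in> mball (f x) ((1/2)^n)"
        by blast
      obtain k where "z = e k"
        unfolding e_def using z(1) D(1) by (metis from_nat_into_surj)
      then have "f x \<in> mball (e k) ((1/2)^n)"
        using z(2) by (simp add: commute)
      then obtain j where "x \<in> F n k j"
        using Feq x by blast
      then have "x \<in> E n (prod_encode (k, j))"
        by (simp add: E_def)
      then show ?thesis ..
    qed
    show "f x \<in> mball (e (fst (prod_decode i))) ((1/2)^n)" if "x \<in> topspace X" "x \<in> E n i" for n i x
    proof -
      have "x \<in> (\<Union>j. F n (fst (prod_decode i)) j)"
        using that(2) by (auto simp: E_def)
      then show ?thesis
        unfolding Feq[symmetric] by blast
    qed
  qed
  with fE show "f \<in> B1 X Y"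
    by (simp add: B1_def Y)
qed

section \<open>Two-valued maps and zero-dimensionality\<close>

lemma functionally_F_sigma_zero_set:
  "zero_set_in X Z \<Longrightarrow> functionally_F_sigma X Z"
  unfolding functionally_F_sigma_def by (intro exI[of _ "\<lambda>_. Z"]) auto

text \<open>A cozero set is the positivity set of the limit of a constant sequence of functions.\<close>
lemma functionally_F_sigma_cozero_set:
  assumes "zero_set_in X Z"
  shows "functionally_F_sigma X (topspace X - Z)"
proof -
  obtain g where g: "continuous_map X (top_of_set {0..1::real}) g" and Z: "Z = {x \<in> topspace X. g x = 0}"
    using assms unfolding zero_set_in_def by blast
  have "functionally_F_sigma X {x \<in> topspace X. 0 < g x}"
    by (rule functionally_F_sigma_limit_positive[where h="\<lambda>_. g"])
       (use g in \<open>auto simp: continuous_map_in_subtopology\<close>)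
  moreover have "{x \<in> topspace X. 0 < g x} = topspace X - Z"
    using g by (force simp: Z continuous_map_in_subtopology image_subset_iff less_le)
  ultimately show ?thesis
    by simp
qed

text \<open>
  Every preimage is one of the four sets \<open>{}\<close>, \<open>Z\<close>, its complement and the whole space.
\<close>
lemma two_valued_map_in_K1:
  assumes Z: "zero_set_in X Z" and ab: "a \<in> topspace Y" "b \<in> topspace Y"
  shows "(\<lambda>x\<in>topspace X. if x \<in> Z then a else b) \<in> K1 X Y"
proof -
  have ZX: "Z \<subseteq> topspace X"
    using Z by (auto simp: zero_set_in_def)
  have empty: "functionally_F_sigma X {}"
    using functionally_F_sigma_zero_set[OF zero_set_in_ge[of X "\<lambda>_. 0" 1]] by simp
  have all: "functionally_F_sigma X (topspace X)"
    using functionally_F_sigma_zero_set[OF zero_set_in_ge[of X "\<lambda>_. 0" 0]] by simp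
  have "functionally_F_sigma X {x \<in> topspace X. (if x \<in> Z then a else b) \<in> V}" for V
  proof -
    have "{x \<in> topspace X. (if x \<in> Z then a else b) \<in> V} =
        (if a \<in> V then if b \<in> V then topspace X else Z else if b \<in> V then topspace X - Z else {})"
      using ZX by auto
    then show ?thesis
      using empty all functionally_F_sigma_zero_set[OF Z] functionally_F_sigma_cozero_set[OF Z] by simp
  qed
  then show ?thesis
    using ab by (simp add: K1_def cong: conj_cong)
qed

text \<open>
  As \<open>A\<close> is open and closed, the limit lies in \<open>A\<close> exactly when the approximating
  sequence is eventually in \<open>A\<close>; and preimages of \<open>A\<close> under continuous maps are clopen.
\<close>
lemma C_sigma_set_B1_vimage_clopen:
  assumes f: "f \<in> B1 X Y" and A: "openin Y A" "closedin Y A"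
  shows "C_sigma_set X {x \<in> topspace X. f x \<in> A}"
proof -
  obtain g where fE: "f \<in> topspace X \<rightarrow>\<^sub>E topspace Y"
    and g: "\<And>n::nat. continuous_map X Y (g n)"
    and lim: "\<And>x. x \<in> topspace X \<Longrightarrow> limitin Y (\<lambda>n. g n x) (f x) sequentially"
    using f unfolding B1_def by blast
  define F where "F n = (\<Inter>m. {x \<in> topspace X. g (n + m) x \<in> A})" for n
  have "C_set X (F n)" for n
    unfolding C_set_def F_def
    using openin_continuous_map_preimage[OF g A(1)] closedin_continuous_map_preimage[OF g A(2)]
    by (intro exI[of _ "\<lambda>m. {x \<in> topspace X. g (n + m) x \<in> A}"]) auto
  moreover have "{x \<in> topspace X. f x \<in> A} = (\<Union>n. F n)"
  proof (intro equalityI subsetI)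
    fix x assume x: "x \<in> {x \<in> topspace X. f x \<in> A}"
    then have "\<forall>\<^sub>F m in sequentially. g m x \<in> A"
      using lim A(1) by (simp add: limitin_def)
    then obtain n where "\<And>m. m \<ge> n \<Longrightarrow> g m x \<in> A"
      by (auto simp: eventually_sequentially)
    with x have "x \<in> F n"
      by (auto simp: F_def)
    then show "x \<in> (\<Union>n. F n)"
      by blast
  next
    fix x assume "x \<in> (\<Union>n. F n)"
    then obtain n where x: "x \<in> topspace X" and n: "\<And>m. g (n + m) x \<in> A"
      by (auto simp: F_def)
    have "\<forall>\<^sub>F m in sequentially. g m x \<in> A"
      using n by (auto simp: eventually_sequentially le_iff_add)
    then have "f x \<in> A"
      using limitin_closedin[OF lim[OF x] A(2)] by simp
    with x show "x \<in> {x \<in> topspace X. f x \<in> A}"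
      by simp
  qed
  ultimately show ?thesis
    unfolding C_sigma_set_def by blast
qed

lemma almost_strongly_zero_dimensional_if_K1_subset_B1:
  assumes "\<not> connected_space Y" and sub: "K1 X Y \<subseteq> B1 X Y"
  shows "almost_strongly_zero_dimensional X"
  unfolding almost_strongly_zero_dimensional_def
proof (intro allI impI)
  fix Z assume Z: "zero_set_in X Z"
  obtain A where A: "openin Y A" "closedin Y A" "A \<noteq> {}" "A \<noteq> topspace Y"
    using assms(1) by (auto simp: connected_space_clopen_in)
  then obtain a b where ab: "a \<in> A" "b \<in> topspace Y" "b \<notin> A"
    using openin_subset by fastforce
  then have aY: "a \<in> topspace Y"
    using A openin_subset by blast
  let ?f = "\<lambda>x\<in>topspace X. if x \<in> Z then a else b"
  have "C_sigma_set X {x \<in> topspace X. ?f x \<in> A}"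
    using C_sigma_set_B1_vimage_clopen[OF _ A(1,2)] two_valued_map_in_K1[OF Z aY ab(2)] sub by blast
  moreover have "{x \<in> topspace X. ?f x \<in> A} = Z"
    using Z ab by (auto simp: zero_set_in_def)
  ultimately show "C_sigma_set X Z"
    by simp
qed

theorem theorem3p15:
  fixes X :: "'a topology" and Y :: "'b topology"
  assumes "metrizable_space Y" and "separable_space Y" and "\<not> connected_space Y"
  shows "almost_strongly_zero_dimensional X \<longleftrightarrow> K1 X Y = B1 X Y"
  using K1_subset_B1[OF assms(1,2)] B1_subset_K1[OF assms(1)]
    almost_strongly_zero_dimensional_if_K1_subset_B1[OF assms(3)]
  by blast

end
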